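(* Let $\mathfrak B$ be the Boolean algebra freely generated by $\{A_1,\dots,A_n\}$, and let $\mathfrak B_1$ and $\mathfrak B_2$ be the subalgebras generated respectively by $\{A_1,\dots,A_k\}$ and $\{A_i,\dots,A_n\}$, with $1\le i\le k\le n$. Let $\mu_1$ and $\mu_2$ be two normalized measures on $\mathfrak B_1$ and $\mathfrak B_2$ respectively, such that $\mu_1$ coincides with $\mu_2$ on $\mathfrak B_1\cap\mathfrak B_2$. Then there exists a measure $\mu$ on $\mathfrak B$ which extends both $\mu_1$ and $\mu_2$.
   Context: A measure on a Boolean algebra is a non-negative real function additive on disjoint elements; it is normalized if its value on the unit is $1$. *)

theory Defs
  imports Complex_Main
begin

text \<open>Boolean algebras are carried by subsets of a type of class \<open>boolean_algebra\<close> that are closed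
  under the operations of the type (possibly the whole type).\<close>

definition subalgebra :: "'a::boolean_algebra set \<Rightarrow> bool" where
  "subalgebra B \<longleftrightarrow> bot \<in> B \<and> top \<in> B \<and> (\<forall>x\<in>B. - x \<in> B) \<and>
     (\<forall>x\<in>B. \<forall>y\<in>B. inf x y \<in> B \<and> sup x y \<in> B)"

definition generated_subalgebra :: "'a::boolean_algebra set \<Rightarrow> 'a set" where
  "generated_subalgebra S = subalgebra hull S"

definition boolean_hom_on ::
    "'a::boolean_algebra set \<Rightarrow> ('a \<Rightarrow> 'b::boolean_algebra) \<Rightarrow> bool" where
  "boolean_hom_on B h \<longleftrightarrow> h bot = bot \<and> h top = top \<and> (\<forall>x\<in>B. h (- x) = - h x) \<and>
     (\<forall>x\<in>B. \<forall>y\<in>B. h (inf x y) = inf (h x) (h y) \<and> h (sup x y) = sup (h x) (h y))"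

text \<open>The family \<open>A\<close>, indexed by \<open>I\<close>, freely generates \<open>B\<close>: it generates \<open>B\<close> and every assignment
  of values to the generators extends to a homomorphism. Since a definition cannot quantify over
  types, the values are taken in the Boolean algebra \<^typ>\<open>nat set\<close>; for finite \<open>I\<close> the property
  for all Boolean algebras follows, see \<open>freely_generated_universal\<close> below. Stating the property
  for the indexed family makes the generators distinct.\<close>

definition freely_generated ::
    "'a::boolean_algebra set \<Rightarrow> ('i \<Rightarrow> 'a) \<Rightarrow> 'i set \<Rightarrow> bool" where
  "freely_generated B A I \<longleftrightarrow> B = generated_subalgebra (A ` I) \<and>
     (\<forall>f :: 'i \<Rightarrow> nat set. \<exists>h. boolean_hom_on B h \<and> (\<forall>j\<in>I. h (A j) = f j))"

definition boolean_measure :: "'a::boolean_algebra set \<Rightarrow> ('a \<Rightarrow> real) \<Rightarrow> bool" where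
  "boolean_measure B \<mu> \<longleftrightarrow> (\<forall>x\<in>B. 0 \<le> \<mu> x) \<and>
     (\<forall>x\<in>B. \<forall>y\<in>B. inf x y = bot \<longrightarrow> \<mu> (sup x y) = \<mu> x + \<mu> y)"

definition normalized_measure :: "'a::boolean_algebra set \<Rightarrow> ('a \<Rightarrow> real) \<Rightarrow> bool" where
  "normalized_measure B \<mu> \<longleftrightarrow> boolean_measure B \<mu> \<and> \<mu> top = 1"

lemma subalgebra_generated: "subalgebra (generated_subalgebra S)"
  unfolding generated_subalgebra_def
  by (rule hull_in) (auto simp: subalgebra_def)

lemma generated_superset: "S \<subseteq> generated_subalgebra S"
  unfolding generated_subalgebra_def by (rule hull_subset)

lemma generated_minimal: "S \<subseteq> T \<Longrightarrow> subalgebra T \<Longrightarrow> generated_subalgebra S \<subseteq> T"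
  unfolding generated_subalgebra_def by (rule hull_minimal)

text \<open>The subalgebra of the product generated by the pairs \<open>(A j, f j)\<close>.\<close>

inductive extension_graph ::
    "('i \<Rightarrow> 'a::boolean_algebra) \<Rightarrow> 'i set \<Rightarrow> ('i \<Rightarrow> 'b::boolean_algebra) \<Rightarrow> 'a \<Rightarrow> 'b \<Rightarrow> bool"
  for A I f where
  gen: "j \<in> I \<Longrightarrow> extension_graph A I f (A j) (f j)"
| bot: "extension_graph A I f bot bot"
| top: "extension_graph A I f top top"
| compl: "extension_graph A I f x y \<Longrightarrow> extension_graph A I f (- x) (- y)"
| inf: "extension_graph A I f x y \<Longrightarrow> extension_graph A I f x' y' \<Longrightarrow>
    extension_graph A I f (inf x x') (inf y y')"
| sup: "extension_graph A I f x y \<Longrightarrow> extension_graph A I f x' y' \<Longrightarrow>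
    extension_graph A I f (sup x x') (sup y y')"

lemma extension_graph_dom:
  "generated_subalgebra (A ` I) = {x. \<exists>y. extension_graph A I f x y}"
proof
  have "subalgebra {x. \<exists>y. extension_graph A I f x y}"
    unfolding subalgebra_def by (blast intro: extension_graph.intros)
  then show "generated_subalgebra (A ` I) \<subseteq> {x. \<exists>y. extension_graph A I f x y}"
    by (intro generated_minimal) (auto intro: extension_graph.intros)
  have "x \<in> generated_subalgebra (A ` I)" if "extension_graph A I f x y" for x y
    using that
  proof induction
    case (gen j)
    then show ?case using generated_superset by blast
  qed (use subalgebra_generated[of "A ` I"] in \<open>auto simp: subalgebra_def\<close>)
  then show "{x. \<exists>y. extension_graph A I f x y} \<subseteq> generated_subalgebra (A ` I)" by blast
qed

lemma deciding_element:
  fixes f :: "'i \<Rightarrow> 'b::boolean_algebra"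
  assumes "finite I" "y \<noteq> bot"
  shows "\<exists>z. z \<noteq> bot \<and> z \<le> y \<and> (\<forall>j\<in>I. z \<le> f j \<or> z \<le> - f j)"
  using assms
proof (induction I)
  case empty
  then show ?case by auto
next
  case (insert i I)
  then obtain z where z: "z \<noteq> bot" "z \<le> y" "\<forall>j\<in>I. z \<le> f j \<or> z \<le> - f j" by auto
  have "z = sup (inf z (f i)) (inf z (- f i))"
    by (simp flip: inf_sup_distrib1)
  then have "inf z (f i) \<noteq> bot \<or> inf z (- f i) \<noteq> bot" using z(1) by force
  then show ?case
  proof
    assume "inf z (f i) \<noteq> bot"
    then show ?thesis using z by (intro exI[of _ "inf z (f i)"]) (auto intro: le_infI1 le_infI2)
  next
    assume "inf z (- f i) \<noteq> bot"
    then show ?thesis using z by (intro exI[of _ "inf z (- f i)"]) (auto intro: le_infI1 le_infI2)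
  qed
qed

lemma extension_graph_bot:
  fixes f :: "'i \<Rightarrow> 'b::boolean_algebra"
  assumes free: "freely_generated B A I" and "finite I" and y: "extension_graph A I f bot y"
  shows "y = bot"
proof (rule ccontr)
  assume "y \<noteq> bot"
  then obtain z where z: "z \<noteq> bot" "z \<le> y" and dec: "\<forall>j\<in>I. z \<le> f j \<or> z \<le> - f j"
    using deciding_element[OF \<open>finite I\<close>] by metis
  obtain h :: "'a \<Rightarrow> nat set" where h: "boolean_hom_on B h"
    and hA: "\<forall>j\<in>I. h (A j) = (if z \<le> f j then UNIV else {})"
    using free unfolding freely_generated_def
    by (auto dest!: spec[of _ "\<lambda>j. if z \<le> f j then UNIV else {}"])
  have B: "B = {x. \<exists>y. extension_graph A I f x y}"
    using free extension_graph_dom unfolding freely_generated_def by metis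
  have h_compl: "h (- x) = - h x" if "extension_graph A I f x u" for x u
    using h that unfolding boolean_hom_on_def B by blast
  have h_inf: "h (inf x x') = h x \<inter> h x'" and h_sup: "h (sup x x') = h x \<union> h x'"
    if "extension_graph A I f x u" "extension_graph A I f x' u'" for x x' u u'
    using h that unfolding boolean_hom_on_def B by blast+
  have not_both: "\<not> (z \<le> u \<and> z \<le> - u)" for u
    using z(1) by (metis bot.extremum_uniqueI inf_compl_bot le_inf_iff)
  have "(z \<le> u \<or> z \<le> - u) \<and> h x = (if z \<le> u then UNIV else {})"
    if "extension_graph A I f x u" for x u
    using that
  proof induction
    case (gen j)
    then show ?case using dec hA by auto
  next
    case bot
    then show ?case using h z(1) by (auto simp: boolean_hom_on_def bot.extremum_unique)
  next
    case top
    then show ?case using h by (auto simp: boolean_hom_on_def)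
  next
    case (compl x u)
    then show ?case using h_compl[OF compl.hyps] not_both[of u] by auto
  next
    case (inf x u x' u')
    then show ?case using h_inf[OF inf.hyps] by (auto intro: le_supI1 le_supI2)
  next
    case (sup x u x' u')
    have "z \<le> - sup u u'" if "\<not> z \<le> u" "\<not> z \<le> u'"
      using sup.IH that by simp
    then show ?case using sup.IH h_sup[OF sup.hyps] not_both[of "sup u u'"]
      by (auto intro: le_supI1 le_supI2)
  qed
  from this[OF y] show False using z(2) h by (auto simp: boolean_hom_on_def)
qed

lemma freely_generated_universal:
  fixes f :: "'i \<Rightarrow> 'b::boolean_algebra"
  assumes free: "freely_generated B A I" and fin: "finite I"
  shows "\<exists>h. boolean_hom_on B h \<and> (\<forall>j\<in>I. h (A j) = f j)"
proof -
  let ?G = "extension_graph A I f"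
  have le: "u \<le> u'" if "?G x u" "?G x u'" for x u u'
  proof -
    have "?G (inf x (- x)) (inf u (- u'))" using that by (intro extension_graph.intros)
    then have "inf u (- u') = bot" using extension_graph_bot[OF free fin, of f] by simp
    then show ?thesis by (simp add: inf_shunt)
  qed
  define h where "h x = (THE u. ?G x u)" for x
  have hI: "h x = u" if "?G x u" for x u
    unfolding h_def using that le by (intro the_equality) (auto intro: antisym)
  have B: "\<exists>u. ?G x u" if "x \<in> B" for x
    using that free extension_graph_dom[of A I f] unfolding freely_generated_def by auto
  have "boolean_hom_on B h"
    unfolding boolean_hom_on_def
  proof (intro conjI ballI)
    fix x y assume "x \<in> B" "y \<in> B"
    then obtain u v where "?G x u" "?G y v" using B by blast
    then show "h (inf x y) = inf (h x) (h y)" "h (sup x y) = sup (h x) (h y)"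
      by (simp_all add: hI extension_graph.intros)
  next
    fix x assume "x \<in> B"
    then obtain u where "?G x u" using B by blast
    then show "h (- x) = - h x" by (simp add: hI extension_graph.intros)
  qed (auto intro: hI extension_graph.intros)
  then show ?thesis using hI extension_graph.gen by metis
qed

end

theory Submission
  imports Defs
begin

text \<open>An element \<open>x\<close> of a free algebra is identified with the set \<open>h x\<close> of truth assignments
  satisfying it, an assignment being given by the set of generators that it makes true. A measure
  on the subalgebra generated by \<open>J\<close> is then a system of weights \<open>p T\<close>, \<open>T \<subseteq> J\<close>. Given weights
  \<open>p\<close> on \<open>J\<close> and \<open>q\<close> on \<open>K\<close> with the same marginal \<open>m\<close> on \<open>J \<inter> K\<close>, the weights
  \<open>p (S \<inter> J) * q (S \<inter> K) / m (S \<inter> J \<inter> K)\<close> make the two systems conditionally independent over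
  \<open>J \<inter> K\<close>, and have marginals \<open>p\<close> and \<open>q\<close>.\<close>

section \<open>Weights on truth assignments and their conditional product\<close>

definition marginal :: "'i set \<Rightarrow> ('i set \<Rightarrow> real) \<Rightarrow> 'i set \<Rightarrow> 'i set \<Rightarrow> real" where
  "marginal J p L U = (\<Sum>T | T \<subseteq> J \<and> T \<inter> L = U. p T)"

lemma marginal_nonneg:
  assumes "\<And>T. T \<subseteq> J \<Longrightarrow> 0 \<le> p T"
  shows "0 \<le> marginal J p L U"
  unfolding marginal_def using assms by (auto intro: sum_nonneg)

text \<open>The sets \<open>S\<close> with \<open>S \<inter> J = T\<close> correspond to the
  \<open>V \<subseteq> K\<close> that agree with \<open>T\<close> on \<open>J \<inter> K\<close>.
  The constant factor comes out of the sum, and the remaining \<open>q V\<close> add up to the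
  denominator. Describing \<open>m\<close> by equations for both systems lets the lemma be reused
  with the two systems exchanged.\<close>

lemma marginal_conditional_product:
  fixes p q m :: "'i set \<Rightarrow> real"
  assumes fin: "finite J" "finite K"
    and p_nonneg: "\<And>T. T \<subseteq> J \<Longrightarrow> 0 \<le> p T"
    and mp: "\<And>U. U \<subseteq> J \<inter> K \<Longrightarrow> m U = marginal J p (J \<inter> K) U"
    and mq: "\<And>U. U \<subseteq> J \<inter> K \<Longrightarrow> m U = marginal K q (J \<inter> K) U"
    and T: "T \<subseteq> J"
  shows "marginal (J \<union> K) (\<lambda>S. p (S \<inter> J) * q (S \<inter> K) / m (S \<inter> (J \<inter> K))) J T = p T"
proof -
  let ?U = "T \<inter> (J \<inter> K)"
  have "marginal (J \<union> K) (\<lambda>S. p (S \<inter> J) * q (S \<inter> K) / m (S \<inter> (J \<inter> K))) J T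
    = (\<Sum>V | V \<subseteq> K \<and> V \<inter> (J \<inter> K) = ?U. p T * q V / m ?U)"
    unfolding marginal_def
  proof (rule sum.reindex_bij_witness[where i = "\<lambda>V. T \<union> V" and j = "\<lambda>S. S \<inter> K"])
    fix S assume S: "S \<in> {S. S \<subseteq> J \<union> K \<and> S \<inter> J = T}"
    show "T \<union> (S \<inter> K) = S" "S \<inter> K \<in> {V. V \<subseteq> K \<and> V \<inter> (J \<inter> K) = ?U}" using S by auto
    have "S \<inter> (J \<inter> K) = ?U" "S \<inter> J = T" using S by auto
    then show "p T * q (S \<inter> K) / m ?U = p (S \<inter> J) * q (S \<inter> K) / m (S \<inter> (J \<inter> K))" by simp
  next
    fix V assume "V \<in> {V. V \<subseteq> K \<and> V \<inter> (J \<inter> K) = ?U}"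
    then show "(T \<union> V) \<inter> K = V" "T \<union> V \<in> {S. S \<subseteq> J \<union> K \<and> S \<inter> J = T}" using T by auto
  qed
  also have "\<dots> = p T * m ?U / m ?U"
    unfolding mq[OF Int_lower2] marginal_def by (simp flip: sum_distrib_left sum_divide_distrib)
  also have "\<dots> = p T"
  proof (cases "m ?U = 0")
    \<comment> \<open>Here the quotient is 0 by the convention for division by zero;
      \<open>p T\<close> vanishes as well, being one of the nonnegative summands of
      \<open>m ?U\<close>.\<close>
    case True
    have "finite {S. S \<subseteq> J \<and> S \<inter> (J \<inter> K) = ?U}"
      using fin(1) by (auto intro: finite_subset[of _ "Pow J"])
    then have "p T \<le> m ?U"
      unfolding mp[OF Int_lower2] marginal_def by (intro member_le_sum) (use T p_nonneg in auto)
    then show ?thesis using True p_nonneg[OF T] by simp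
  qed simp
  finally show ?thesis .
qed

section \<open>Induction and closure for generated subalgebras\<close>

text \<open>The induction steps also supply membership in the subalgebra, because
  \<open>boolean_hom_on\<close> gives its equations only there.\<close>

lemma generated_induct [consumes 1, case_names gen bot top compl inf sup]:
  assumes x: "x \<in> generated_subalgebra S"
    and gen: "\<And>s. s \<in> S \<Longrightarrow> P s" and bot: "P bot" and top: "P top"
    and compl: "\<And>y. y \<in> generated_subalgebra S \<Longrightarrow> P y \<Longrightarrow> P (- y)"
    and inf: "\<And>y z. y \<in> generated_subalgebra S \<Longrightarrow> z \<in> generated_subalgebra S \<Longrightarrow>
      P y \<Longrightarrow> P z \<Longrightarrow> P (inf y z)"
    and sup: "\<And>y z. y \<in> generated_subalgebra S \<Longrightarrow> z \<in> generated_subalgebra S \<Longrightarrow>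
      P y \<Longrightarrow> P z \<Longrightarrow> P (sup y z)"
  shows "P x"
proof -
  have "generated_subalgebra S \<subseteq> {x \<in> generated_subalgebra S. P x}"
  proof (rule generated_minimal)
    show "S \<subseteq> {x \<in> generated_subalgebra S. P x}" using gen generated_superset by blast
    show "subalgebra {x \<in> generated_subalgebra S. P x}"
      using subalgebra_generated[of S] bot top compl inf sup unfolding subalgebra_def by blast
  qed
  then show ?thesis using x by blast
qed

lemma generated_mono: "S \<subseteq> T \<Longrightarrow> generated_subalgebra S \<subseteq> generated_subalgebra T"
  by (meson generated_minimal generated_superset subalgebra_generated subset_trans)

lemma generated_closed:
  shows "bot \<in> generated_subalgebra S" "top \<in> generated_subalgebra S"
    and "x \<in> generated_subalgebra S \<Longrightarrow> - x \<in> generated_subalgebra S"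
    and "x \<in> generated_subalgebra S \<Longrightarrow> y \<in> generated_subalgebra S \<Longrightarrow>
      inf x y \<in> generated_subalgebra S"
    and "x \<in> generated_subalgebra S \<Longrightarrow> y \<in> generated_subalgebra S \<Longrightarrow>
      sup x y \<in> generated_subalgebra S"
  using subalgebra_generated[of S] unfolding subalgebra_def by auto

section \<open>Elements of the free algebra as sets of truth assignments\<close>

text \<open>Freeness enters only through the existence of \<open>h\<close>. Assignments range over
  the whole type \<open>'i set\<close>, so sums of weights below are cut down to
  \<open>Pow J\<close> or \<open>Pow I\<close>.\<close>

locale assignment_model =
  fixes A :: "'i \<Rightarrow> 'a::boolean_algebra" and I :: "'i set" and h :: "'a \<Rightarrow> 'i set set"
  assumes finite_I: "finite I"
    and hom: "boolean_hom_on (generated_subalgebra (A ` I)) h"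
    and h_gen: "j \<in> I \<Longrightarrow> h (A j) = {S. j \<in> S}"
begin

abbreviation gen :: "'i set \<Rightarrow> 'a set" where
  "gen J \<equiv> generated_subalgebra (A ` J)"

lemma gen_subset: "J \<subseteq> K \<Longrightarrow> gen J \<subseteq> gen K"
  by (intro generated_mono image_mono)

lemma h_simps:
  shows "h bot = {}" "h top = UNIV"
    and "x \<in> gen I \<Longrightarrow> h (- x) = - h x"
    and "x \<in> gen I \<Longrightarrow> y \<in> gen I \<Longrightarrow> h (inf x y) = h x \<inter> h y"
    and "x \<in> gen I \<Longrightarrow> y \<in> gen I \<Longrightarrow> h (sup x y) = h x \<union> h y"
  using hom by (auto simp: boolean_hom_on_def)

text \<open>Membership of \<open>S\<close> in \<open>h (A j)\<close> tests only \<open>j\<close>,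
  and the Boolean operations introduce no dependence on further indices.\<close>

lemma h_local:
  assumes "J \<subseteq> I" "x \<in> gen J"
  shows "S \<in> h x \<longleftrightarrow> S \<inter> J \<in> h x"
  using assms(2)
proof (induction rule: generated_induct)
  case (gen s)
  then show ?case using assms(1) by (auto simp: h_gen subset_iff)
qed (use gen_subset[OF assms(1)] in \<open>auto simp: h_simps subset_iff\<close>)

text \<open>Below a nonzero \<open>x\<close> lies a nonzero \<open>z\<close> that decides every
  generator, hence every element of \<open>gen I\<close>. The generators above \<open>z\<close> form
  an assignment that satisfies exactly the elements above \<open>z\<close>, in particular
  \<open>x\<close>.\<close>

lemma h_eq_empty:
  assumes "x \<in> gen I" "h x = {}"
  shows "x = bot"
proof (rule ccontr)
  assume "x \<noteq> bot"
  then obtain z where z: "z \<noteq> bot" "z \<le> x" and dec: "\<forall>j\<in>I. z \<le> A j \<or> z \<le> - A j"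
    using deciding_element[OF finite_I] by metis
  have not_both: "\<not> (z \<le> u \<and> z \<le> - u)" for u
    using z(1) by (metis bot.extremum_uniqueI inf_compl_bot le_inf_iff)
  let ?S = "{j. z \<le> A j}"
  have "(z \<le> y \<or> z \<le> - y) \<and> (?S \<in> h y \<longleftrightarrow> z \<le> y)" if "y \<in> gen I" for y
    using that
  proof (induction rule: generated_induct)
    case (gen s)
    then show ?case using dec by (auto simp: h_gen)
  next
    case bot
    then show ?case using z(1) by (auto simp: h_simps bot.extremum_unique)
  next
    case top
    then show ?case by (auto simp: h_simps)
  next
    case (compl y)
    then show ?case using not_both[of y] by (auto simp: h_simps)
  next
    case (inf y y')
    then show ?case by (auto simp: h_simps intro: le_supI1 le_supI2)
  next
    case (sup y y')
    have "z \<le> - sup y y'" if "\<not> z \<le> y" "\<not> z \<le> y'" using sup.IH that by simp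
    then show ?case using sup not_both[of "sup y y'"]
      by (auto simp: h_simps intro: le_supI1 le_supI2)
  qed
  then show False using assms z(2) by blast
qed

lemma h_inject:
  assumes "x \<in> gen I" "y \<in> gen I" "h x = h y"
  shows "x = y"
proof (rule antisym)
  have "inf x (- y) = bot" "inf y (- x) = bot"
    using assms by (auto intro!: h_eq_empty simp: h_simps generated_closed)
  then show "x \<le> y" "y \<le> x" by (simp_all add: inf_shunt)
qed

text \<open>The witness is the meet of the \<open>A j\<close> with \<open>j \<in> T\<close> and the
  \<open>- A j\<close> with \<open>j \<in> J - T\<close>, built one generator at a time.\<close>

lemma atom_exists:
  assumes "J \<subseteq> I" "T \<subseteq> J"
  shows "\<exists>a\<in>gen J. h a = {S. S \<inter> J = T}"
proof -
  have "finite J" using assms(1) finite_I finite_subset by blast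
  then show ?thesis using assms
  proof (induction J arbitrary: T)
    case empty
    then show ?case by (auto intro!: bexI[of _ top] simp: h_simps generated_closed)
  next
    case (insert j J)
    have "\<exists>a\<in>gen J. h a = {S. S \<inter> J = T - {j}}"
      using insert.prems by (intro insert.IH) auto
    then obtain a where a: "a \<in> gen J" "h a = {S. S \<inter> J = T - {j}}" by blast
    have sub: "gen J \<subseteq> gen (insert j J)" by (intro gen_subset subset_insertI)
    have subI: "gen (insert j J) \<subseteq> gen I" by (intro gen_subset insert.prems(1))
    have j: "j \<in> I" using insert.prems(1) by simp
    have Aj: "A j \<in> gen (insert j J)" by (intro generated_superset[THEN subsetD]) simp
    define b where "b = (if j \<in> T then A j else - A j)"
    have b: "b \<in> gen (insert j J)" using Aj by (simp add: b_def generated_closed)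
    have "h b = {S. j \<in> S \<longleftrightarrow> j \<in> T}"
      using subsetD[OF subI Aj] j by (auto simp: b_def h_simps h_gen)
    moreover have "h (inf a b) = h a \<inter> h b"
      by (rule h_simps(4)) (use a(1) b sub subI in blast)+
    ultimately have "h (inf a b) = {S. S \<inter> insert j J = T}"
      using a(2) insert.hyps(2) insert.prems(2) by auto
    moreover have "inf a b \<in> gen (insert j J)"
      by (rule generated_closed(4)) (use a(1) b sub in blast)+
    ultimately show ?case by blast
  qed
qed

section \<open>Measures as systems of weights\<close>

text \<open>The weight of \<open>T\<close> is the measure of its atom. Since \<open>h\<close> is
  injective on \<open>gen I\<close>, each \<open>x\<close> is the join of the disjoint atoms whose
  assignments satisfy it, and additivity applies.\<close>

lemma measure_weights:
  assumes J: "J \<subseteq> I" and \<mu>: "boolean_measure (gen J) \<mu>"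
  shows "\<exists>p. (\<forall>T\<subseteq>J. 0 \<le> p T) \<and> (\<forall>x\<in>gen J. \<mu> x = (\<Sum>T\<in>Pow J \<inter> h x. p T))"
proof -
  have sub: "gen J \<subseteq> gen I" using gen_subset[OF J] .
  have finJ: "finite J" using J finite_I finite_subset by blast
  have add: "\<mu> (sup x y) = \<mu> x + \<mu> y" if "x \<in> gen J" "y \<in> gen J" "inf x y = bot" for x y
    using \<mu> that by (auto simp: boolean_measure_def)
  obtain a where a: "\<And>T. T \<subseteq> J \<Longrightarrow> a T \<in> gen J \<and> h (a T) = {S. S \<inter> J = T}"
    using atom_exists[OF J] by metis
  \<comment> \<open>Atoms are joined one by one; the images under \<open>h\<close> show that each
    new atom is disjoint from the join so far.\<close>
  have union: "\<exists>y\<in>gen J. h y = {S. S \<inter> J \<in> F} \<and> \<mu> y = (\<Sum>T\<in>F. \<mu> (a T))"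
    if "finite F" "F \<subseteq> Pow J" for F
    using that
  proof (induction F)
    case empty
    have "\<mu> bot = 0" using add[of bot bot] generated_closed(1) by auto
    then show ?case using generated_closed(1) h_simps(1) by auto
  next
    case (insert T F)
    then obtain y where y: "y \<in> gen J" "h y = {S. S \<inter> J \<in> F}" "\<mu> y = (\<Sum>T\<in>F. \<mu> (a T))"
      by auto
    have aT: "a T \<in> gen J" "h (a T) = {S. S \<inter> J = T}" using a insert.prems by auto
    have "h (inf (a T) y) = {}"
      using y aT sub insert.hyps(2) by (subst h_simps) auto
    then have "inf (a T) y = bot"
      using y(1) aT(1) sub by (intro h_eq_empty) (auto intro: generated_closed)
    then have "\<mu> (sup (a T) y) = (\<Sum>T\<in>insert T F. \<mu> (a T))"
      using add aT(1) y insert.hyps by simp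
    moreover have "h (sup (a T) y) = {S. S \<inter> J \<in> insert T F}"
      using y aT sub by (subst h_simps) auto
    ultimately show ?case using aT(1) y(1) generated_closed(5) by blast
  qed
  have "\<mu> x = (\<Sum>T\<in>Pow J \<inter> h x. \<mu> (a T))" if x: "x \<in> gen J" for x
  proof -
    obtain y where y: "y \<in> gen J" "h y = {S. S \<inter> J \<in> Pow J \<inter> h x}"
      "\<mu> y = (\<Sum>T\<in>Pow J \<inter> h x. \<mu> (a T))"
      using union[of "Pow J \<inter> h x"] finJ by auto
    have "h y = h x" unfolding y(2) using h_local[OF J x] by blast
    then show ?thesis using h_inject x y sub by blast
  qed
  moreover have "\<forall>T\<subseteq>J. 0 \<le> \<mu> (a T)" using \<mu> a by (auto simp: boolean_measure_def)
  ultimately show ?thesis by (intro exI[of _ "\<lambda>T. \<mu> (a T)"]) auto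
qed

lemma weights_measure:
  assumes "\<And>S. S \<subseteq> I \<Longrightarrow> 0 \<le> w S"
  shows "boolean_measure (gen I) (\<lambda>x. \<Sum>S\<in>Pow I \<inter> h x. w S)"
  unfolding boolean_measure_def
proof (intro conjI ballI impI)
  fix x y assume xy: "x \<in> gen I" "y \<in> gen I" "inf x y = bot"
  then have "h x \<inter> h y = {}" using h_simps by metis
  moreover have "Pow I \<inter> h (sup x y) = (Pow I \<inter> h x) \<union> (Pow I \<inter> h y)"
    using xy by (auto simp: h_simps)
  ultimately show "(\<Sum>S\<in>Pow I \<inter> h (sup x y). w S)
    = (\<Sum>S\<in>Pow I \<inter> h x. w S) + (\<Sum>S\<in>Pow I \<inter> h y. w S)"
    using finite_I by (simp add: sum.union_disjoint disjoint_iff)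
qed (use assms in \<open>auto intro: sum_nonneg\<close>)

text \<open>Group the assignments by their restriction to \<open>J\<close>: by
  \<open>h_local\<close>, membership in \<open>h x\<close> is constant on each group.\<close>

lemma sum_weights_marginal:
  assumes J: "J \<subseteq> I" and x: "x \<in> gen J"
  shows "(\<Sum>S\<in>Pow I \<inter> h x. w S) = (\<Sum>T\<in>Pow J \<inter> h x. marginal I w J T)"
proof -
  have "finite J" using J finite_I finite_subset by blast
  then have "(\<Sum>S\<in>Pow I \<inter> h x. w S)
    = (\<Sum>T\<in>Pow J \<inter> h x. \<Sum>S | S \<in> Pow I \<inter> h x \<and> S \<inter> J = T. w S)"
    using finite_I by (intro sum.group[symmetric]) (auto simp flip: h_local[OF J x])
  also have "\<dots> = (\<Sum>T\<in>Pow J \<inter> h x. marginal I w J T)"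
    unfolding marginal_def by (intro sum.cong refl) (use h_local[OF J x] in blast)
  finally show ?thesis .
qed

section \<open>Gluing two measures\<close>

lemma common_extension:
  assumes I: "I = J \<union> K"
    and \<mu>: "boolean_measure (gen J) \<mu>" and \<nu>: "boolean_measure (gen K) \<nu>"
    and agree: "\<And>x. x \<in> gen (J \<inter> K) \<Longrightarrow> \<mu> x = \<nu> x"
  shows "\<exists>\<rho>. boolean_measure (gen I) \<rho> \<and> (\<forall>x\<in>gen J. \<rho> x = \<mu> x) \<and> (\<forall>x\<in>gen K. \<rho> x = \<nu> x)"
proof -
  have sub: "J \<subseteq> I" "K \<subseteq> I" "J \<inter> K \<subseteq> I" and fin: "finite J" "finite K"
    using I finite_I by auto
  obtain p where p: "\<And>T. T \<subseteq> J \<Longrightarrow> 0 \<le> p T"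
    "\<And>x. x \<in> gen J \<Longrightarrow> \<mu> x = (\<Sum>T\<in>Pow J \<inter> h x. p T)"
    using measure_weights[OF sub(1) \<mu>] by blast
  obtain q where q: "\<And>T. T \<subseteq> K \<Longrightarrow> 0 \<le> q T"
    "\<And>x. x \<in> gen K \<Longrightarrow> \<nu> x = (\<Sum>T\<in>Pow K \<inter> h x. q T)"
    using measure_weights[OF sub(2) \<nu>] by blast
  define m where "m = marginal J p (J \<inter> K)"
  \<comment> \<open>Both marginals at \<open>U\<close> are the measure of the atom of
    \<open>U\<close> in \<open>gen (J \<inter> K)\<close>, where \<open>\<mu>\<close> and
    \<open>\<nu>\<close> agree.\<close>
  have mq: "m U = marginal K q (J \<inter> K) U" if U: "U \<subseteq> J \<inter> K" for U
  proof -
    obtain a where a: "a \<in> gen (J \<inter> K)" "h a = {S. S \<inter> (J \<inter> K) = U}"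
      using atom_exists[OF sub(3) U] by blast
    then have "a \<in> gen J" "a \<in> gen K" using gen_subset by (meson inf_le1 inf_le2 subsetD)+
    then have "(\<Sum>T\<in>Pow J \<inter> h a. p T) = (\<Sum>T\<in>Pow K \<inter> h a. q T)"
      using p(2) q(2) agree[OF a(1)] by simp
    moreover have "Pow L \<inter> h a = {T. T \<subseteq> L \<and> T \<inter> (J \<inter> K) = U}" for L
      using a(2) by auto
    ultimately show ?thesis by (simp add: m_def marginal_def)
  qed
  define w where "w S = p (S \<inter> J) * q (S \<inter> K) / m (S \<inter> (J \<inter> K))" for S
  have "0 \<le> w S" for S
    unfolding w_def m_def using p(1) q(1)
    by (intro divide_nonneg_nonneg mult_nonneg_nonneg marginal_nonneg) auto
  then have "boolean_measure (gen I) (\<lambda>x. \<Sum>S\<in>Pow I \<inter> h x. w S)"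
    by (intro weights_measure)
  moreover have "marginal I w J T = p T" if "T \<subseteq> J" for T
    using marginal_conditional_product[OF fin, of p m q T] p(1) mq that
    by (simp add: m_def I w_def[abs_def])
  \<comment> \<open>The formula for \<open>w\<close> is symmetric in the two systems and
    \<open>m\<close> is a marginal of either, so the same lemma applies with the roles
    exchanged.\<close>
  moreover have "marginal I w K T = q T" if "T \<subseteq> K" for T
    using marginal_conditional_product[OF fin(2,1), of q m p T] q(1) mq that
    by (simp add: m_def I w_def[abs_def] Int_commute Un_commute mult.commute)
  ultimately show ?thesis
    using sum_weights_marginal sub p(2) q(2)
    by (intro exI[of _ "\<lambda>x. \<Sum>S\<in>Pow I \<inter> h x. w S"]) (auto intro!: sum.cong)
qed

end

theorem theoremV1:
  fixes \<BB> :: "'a::boolean_algebra set" and A :: "nat \<Rightarrow> 'a" and n i k :: nat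
    and \<BB>\<^sub>1 \<BB>\<^sub>2 :: "'a set" and \<mu>\<^sub>1 \<mu>\<^sub>2 :: "'a \<Rightarrow> real"
  assumes "freely_generated \<BB> A {1..n}"
    and "\<BB>\<^sub>1 = generated_subalgebra (A ` {1..k})"
    and "\<BB>\<^sub>2 = generated_subalgebra (A ` {i..n})"
    and "1 \<le> i" and "i \<le> k" and "k \<le> n"
    and "normalized_measure \<BB>\<^sub>1 \<mu>\<^sub>1"
    and "normalized_measure \<BB>\<^sub>2 \<mu>\<^sub>2"
    and "\<forall>x \<in> \<BB>\<^sub>1 \<inter> \<BB>\<^sub>2. \<mu>\<^sub>1 x = \<mu>\<^sub>2 x"
  shows "\<exists>\<mu>. boolean_measure \<BB> \<mu> \<and> (\<forall>x\<in>\<BB>\<^sub>1. \<mu> x = \<mu>\<^sub>1 x) \<and> (\<forall>x\<in>\<BB>\<^sub>2. \<mu> x = \<mu>\<^sub>2 x)"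
proof -
  have B: "\<BB> = generated_subalgebra (A ` {1..n})"
    using assms(1) by (simp add: freely_generated_def)
  \<comment> \<open>The values lie in \<open>nat set set\<close>, so the universal property for
    arbitrary Boolean algebras is invoked rather than the definition with
    \<open>nat set\<close>.\<close>
  obtain h :: "'a \<Rightarrow> nat set set" where "boolean_hom_on \<BB> h"
    "\<forall>j\<in>{1..n}. h (A j) = {S. j \<in> S}"
    using freely_generated_universal[OF assms(1), of "\<lambda>j. {S. j \<in> S}"] by auto
  then interpret assignment_model A "{1..n}" h
    by unfold_locales (auto simp: B)
  \<comment> \<open>Agreement on the intersection thus yields agreement on the subalgebra of the
    common generators, as \<open>common_extension\<close> requires.\<close>
  have "gen ({1..k} \<inter> {i..n}) \<subseteq> \<BB>\<^sub>1 \<inter> \<BB>\<^sub>2"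
    unfolding assms(2,3) by (intro Int_greatest gen_subset) auto
  moreover have "{1..n} = {1..k} \<union> {i..n}" using assms(4-6) by auto
  ultimately show ?thesis
    using common_extension[of "{1..k}" "{i..n}" \<mu>\<^sub>1 \<mu>\<^sub>2] assms(7-9)
    unfolding B assms(2,3) normalized_measure_def by blast
qed

end
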